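(* Let $M=(E,\mathcal{I})$ be a gammoid. Then there is an acyclic digraph $D=(V,A)$ and sets $T,E'\subseteq V$ (with $E\subseteq E'$) such that $$M=\Gamma(D,T,E').E\qquad\text{and}\qquad |T|=\operatorname{rk}_M(E)+|E'\setminus E|,$$ where $N.E$ denotes the contraction of the matroid $N$ to $E$.
   Context: A digraph is a pair $D=(V,A)$ with $V$ finite and $A\subseteq V\times V$ (loops allowed). A walk is a non-empty sequence $w_1w_2\ldots w_n$ of vertices with $(w_i,w_{i+1})\in A$ for $1\le i<n$; a path is a walk without repeated vertices (a single vertex is a path). A cycle is a walk $c_1c_2\ldots c_n$ with $n>1$, $c_1=c_n$ and $c_1\ldots c_{n-1}$ a path (so loops are cycles); $D$ is acyclic if it has no cycle. For $X,Y\subseteq V$, a routing from $X$ to $Y$ in $D$ is a family $R$ of pairwise vertex-disjoint paths of $D$ such that every $p\in R$ starts in $X$, every $x\in X$ is the first vertex of some $p\in R$, and every $p\in R$ ends in $Y$. For $T,E\subseteq V$, $\Gamma(D,T,E)$ is the matroid on $E$ whose independent sets are those $X\subseteq E$ for which there is a routing from $X$ to $T$ in $D$. A matroid $M$ on a finite set $E$ is a gammoid if $M=\Gamma(D,T,E)$ for some digraph $D=(V,A)$ with $E\subseteq V$ and some $T\subseteq V$. For a matroid $N$ on ground set $E_N$ and $X\subseteq E_N$, the contraction of $N$ to $X$, written $N.X$, is the matroid on $X$ obtained by contracting $E_N\setminus X$, i.e. $N.X=N/(E_N\setminus X)$. $\operatorname{rk}_M$ is the rank function of $M$. *)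

theory Defs
  imports
    "HOL-Library.Infinite_Typeclass"
    "Graph_Theory.Pair_Digraph"
    "Graph_Theory.Vertex_Walk"
begin

section \<open>Matroids\<close>

type_synonym 'a set_system = "'a set \<times> 'a set set"

abbreviation ground :: "'a set_system \<Rightarrow> 'a set" where
  "ground M \<equiv> fst M"

abbreviation indeps :: "'a set_system \<Rightarrow> 'a set set" where
  "indeps M \<equiv> snd M"

definition matroid :: "'a set_system \<Rightarrow> bool" where
  "matroid M \<longleftrightarrow>
     finite (ground M) \<and>
     indeps M \<subseteq> Pow (ground M) \<and>
     {} \<in> indeps M \<and>
     (\<forall>X Y. X \<in> indeps M \<and> Y \<subseteq> X \<longrightarrow> Y \<in> indeps M) \<and>
     (\<forall>X Y. X \<in> indeps M \<and> Y \<in> indeps M \<and> card X < card Y \<longrightarrow>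
        (\<exists>y\<in>Y - X. insert y X \<in> indeps M))"

definition rk :: "'a set_system \<Rightarrow> 'a set \<Rightarrow> nat" where
  "rk M X = Max (card ` {Y. Y \<subseteq> X \<and> Y \<in> indeps M})"

definition basis_of :: "'a set_system \<Rightarrow> 'a set \<Rightarrow> 'a set \<Rightarrow> bool" where
  "basis_of M C B \<longleftrightarrow>
     B \<subseteq> C \<and> B \<in> indeps M \<and> (\<forall>x\<in>C - B. insert x B \<notin> indeps M)"

text \<open>The contraction \<open>M / C\<close>. If \<open>M\<close> is a matroid, the condition does not depend on the
  choice of the basis \<open>B\<close> of \<open>C\<close>.\<close>

definition contract :: "'a set_system \<Rightarrow> 'a set \<Rightarrow> 'a set_system" where
  "contract M C =
     (ground M - C,
      {X. X \<subseteq> ground M - C \<and> (\<exists>B. basis_of M C B \<and> X \<union> B \<in> indeps M)})"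

text \<open>The contraction of \<open>M\<close> to \<open>X\<close>, usually written \<open>M.X\<close>: here \<open>X\<close> is what remains.\<close>

definition contract_to :: "'a set_system \<Rightarrow> 'a set \<Rightarrow> 'a set_system" where
  "contract_to M X = contract M (ground M - X)"


section \<open>Digraphs, routings and gammoids\<close>

text \<open>Digraphs \<open>(V,A)\<close> with \<open>V\<close> finite and \<open>A \<subseteq> V \<times> V\<close> (loops allowed) are the pair digraphs
  satisfying \<^term>\<open>pair_fin_digraph\<close>; walks and paths are the library's vertex walks
  \<^term>\<open>vwalk\<close> and \<^term>\<open>vpath\<close>, which are non-empty lists of vertices.\<close>

definition cycle_walk :: "'a pair_pre_digraph \<Rightarrow> 'a vwalk \<Rightarrow> bool" where
  "cycle_walk D c \<longleftrightarrow>
     vwalk c (with_proj D) \<and> length c > 1 \<and> hd c = last c \<and> vpath (butlast c) (with_proj D)"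

definition acyclic_digraph :: "'a pair_pre_digraph \<Rightarrow> bool" where
  "acyclic_digraph D \<longleftrightarrow> \<not> (\<exists>c. cycle_walk D c)"

definition routing :: "'a pair_pre_digraph \<Rightarrow> 'a set \<Rightarrow> 'a set \<Rightarrow> 'a vwalk set \<Rightarrow> bool" where
  "routing D X Y R \<longleftrightarrow>
     (\<forall>p\<in>R. vpath p (with_proj D)) \<and>
     (\<forall>p\<in>R. \<forall>q\<in>R. p \<noteq> q \<longrightarrow> set p \<inter> set q = {}) \<and>
     (\<forall>p\<in>R. hd p \<in> X) \<and>
     (\<forall>x\<in>X. \<exists>p\<in>R. hd p = x) \<and>
     (\<forall>p\<in>R. last p \<in> Y)"

definition gammoid_of :: "'a pair_pre_digraph \<Rightarrow> 'a set \<Rightarrow> 'a set \<Rightarrow> 'a set_system" where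
  "gammoid_of D T E = (E, {X. X \<subseteq> E \<and> (\<exists>R. routing D X T R)})"

text \<open>The digraph may have arbitrarily many vertices outside the ground set. They are taken from
  the type of the ground set, which therefore has to be infinite; then every finite digraph whose
  vertex set contains \<open>E\<close> has, up to an isomorphism fixing \<open>E\<close>, its vertices in that type.\<close>

definition gammoid :: "('a::infinite) set_system \<Rightarrow> bool" where
  "gammoid M \<longleftrightarrow>
     matroid M \<and>
     (\<exists>D T. pair_fin_digraph D \<and> ground M \<subseteq> pverts D \<and> T \<subseteq> pverts D \<and>
            M = gammoid_of D T (ground M))"

end

theory Submission
  imports Defs
begin

text \<open>
  Let \<open>M = \<Gamma>(D,T,E)\<close> with \<open>D = (V,A)\<close>. The idea is that a routing is the same thing as a matching
  in a bipartite graph, and that a bipartite graph with all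
  arcs directed from one side to the other is trivially an acyclic digraph, since no walk in it
  has more than one arc. The matroid of such a digraph is a transversal matroid.

  The translation is the Linkage Lemma of Ingleton and Piff: \<open>X\<close> can be routed to \<open>T\<close> if and only
  if there are a set \<open>U \<subseteq> T\<close> of end vertices and an injective map from \<open>V - U\<close> to \<open>V - X\<close> that sends
  every vertex to itself or along an arc. Given a routing, send every vertex to its successor on
  its path, and vertices off all paths to themselves. Conversely, iterate the map on the elements
  of \<open>X\<close>; as they are outside its range, injectivity forbids that the orbits return, stay in the
  finite set \<open>V - U\<close> forever, or meet (\<open>routing_imp_linkage\<close> and \<open>linkage_imp_routing\<close>).

  Such a map is encoded as a matching as follows. Give each \<open>v \<in> V\<close> two new copies, a departure
  vertex \<open>dep v\<close> and an arrival vertex \<open>arr v\<close>, and add a set \<open>S\<close> of \<open>rk\<^sub>M(E)\<close> further vertices.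
  The arcs are \<open>(e, arr e)\<close> for \<open>e \<in> E\<close>, \<open>(dep v, arr w)\<close> for \<open>v = w\<close> or \<open>(v,w) \<in> A\<close>, and all
  \<open>(dep t, s)\<close> with \<open>t \<in> T\<close> and \<open>s \<in> S\<close>. The ground set \<open>E'\<close> consists of \<open>E\<close> and the departure
  vertices, the new target set of \<open>S\<close> and the arrival vertices. An element
  \<open>x \<in> X\<close> has \<open>arr x\<close> as its only partner and so blocks it; hence matching \<open>X\<close> together with all
  departure vertices means to give an injective map as above, where \<open>U\<close> consists of those \<open>t\<close> for
  which \<open>dep t\<close> is matched into \<open>S\<close>. The size of \<open>S\<close> is no restriction, because no independent set
  of \<open>M\<close> is larger than \<open>rk\<^sub>M(E)\<close>. The set of all departure vertices is independent, by matching
  \<open>dep v\<close> with \<open>arr v\<close>, so contracting it leaves exactly the sets \<open>X\<close> for which \<open>X\<close> and all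
  departure vertices can be matched, that is, the independent sets of \<open>M\<close>. Finally, there are
  \<open>card V\<close> arrival vertices, as many as the contracted departure vertices, and \<open>rk\<^sub>M(E)\<close> elements
  of \<open>S\<close>, which is the required size of the target set.
\<close>

section \<open>Walks and arcs\<close>

lemma set_vwalk_arcs_conv_nth:
  "set (vwalk_arcs p) = {(p ! i, p ! Suc i) | i. Suc i < length p}"
proof (induction p rule: vwalk_arcs.induct)
  case (3 x y xs)
  have "{((x # y # xs) ! i, (x # y # xs) ! Suc i) | i. Suc i < length (x # y # xs)}
    = insert (x, y) {((y # xs) ! i, (y # xs) ! Suc i) | i. Suc i < length (y # xs)}"
    (is "?L = ?R")
  proof
    show "?L \<subseteq> ?R"
    proof
      fix a assume "a \<in> ?L"
      then obtain i where "a = ((x # y # xs) ! i, (x # y # xs) ! Suc i)"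
        "Suc i < length (x # y # xs)" by blast
      then show "a \<in> ?R" by (cases i) auto
    qed
    show "?R \<subseteq> ?L" by (auto intro: exI[of _ 0] exI[of _ "Suc i" for i])
  qed
  then show ?case using 3 by simp
qed auto

lemma vpath_iff_nth:
  "vpath p (with_proj D) \<longleftrightarrow>
     p \<noteq> [] \<and> distinct p \<and> set p \<subseteq> pverts D \<and>
     (\<forall>i. Suc i < length p \<longrightarrow> (p ! i, p ! Suc i) \<in> parcs D)"
  by (auto simp: vpath_def vwalk_def set_vwalk_arcs_conv_nth)

section \<open>Routings in bipartite digraphs\<close>

lemma acyclic_bipartite:
  assumes "parcs D \<subseteq> L \<times> T" "L \<inter> T = {}"
  shows "acyclic_digraph D"
  unfolding acyclic_digraph_def
proof
  assume "\<exists>c. cycle_walk D c"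
  then obtain c where c: "vwalk c (with_proj D)" "length c > 1" "hd c = last c"
    by (auto simp: cycle_walk_def)
  then obtain a b cs where abc: "c = a # b # cs"
    by (metis One_nat_def length_0_conv length_Suc_conv less_numeral_extra(4) list.exhaust
        not_less_zero)
  show False
    using c assms unfolding abc by (cases cs) (auto simp: vwalk_def)
qed

lemma bipartite_routing_iff_matching:
  assumes arcs: "parcs D \<subseteq> L \<times> T" and disj: "L \<inter> T = {}" and verts: "L \<union> T \<subseteq> pverts D"
    and YL: "Y \<subseteq> L"
  shows "(\<exists>R. routing D Y T R) \<longleftrightarrow> (\<exists>f. inj_on f Y \<and> (\<forall>y\<in>Y. (y, f y) \<in> parcs D))"
proof
  assume "\<exists>R. routing D Y T R"
  then obtain R where R: "routing D Y T R" ..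
  have short: "\<exists>b. p = [y, b] \<and> (y, b) \<in> parcs D" if "p \<in> R" "hd p = y" "y \<in> Y" for p y
  proof -
    have p: "vwalk p (with_proj D)" "last p \<in> T"
      using R that by (auto simp: routing_def)
    have "p = y # tl p" using p that by (cases p) (auto simp: vwalk_def)
    then obtain q where q: "p = y # q" by blast
    have "q \<noteq> []" using p q that YL disj by auto
    then obtain b r where "q = b # r" by (cases q) auto
    then show ?thesis using p q arcs disj by (cases r) (auto simp: vwalk_def)
  qed
  have "\<forall>y\<in>Y. \<exists>b. [y, b] \<in> R \<and> (y, b) \<in> parcs D"
    using R short unfolding routing_def by metis
  then obtain f where f: "\<forall>y\<in>Y. [y, f y] \<in> R \<and> (y, f y) \<in> parcs D"
    by metis
  have "inj_on f Y"
  proof (rule inj_onI)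
    fix x y assume xy: "x \<in> Y" "y \<in> Y" "f x = f y"
    have "set [x, f x] \<inter> set [y, f y] \<noteq> {}" using xy by auto
    then have "[x, f x] = [y, f y]" using R f xy unfolding routing_def by blast
    then show "x = y" by simp
  qed
  then show "\<exists>f. inj_on f Y \<and> (\<forall>y\<in>Y. (y, f y) \<in> parcs D)" using f by blast
next
  assume "\<exists>f. inj_on f Y \<and> (\<forall>y\<in>Y. (y, f y) \<in> parcs D)"
  then obtain f where f: "inj_on f Y" "\<forall>y\<in>Y. (y, f y) \<in> parcs D" by blast
  have in_T: "f y \<in> T" if "y \<in> Y" for y using f(2) arcs that by auto
  have "routing D Y T ((\<lambda>y. [y, f y]) ` Y)"
    unfolding routing_def
  proof (intro conjI ballI impI)
    fix p assume "p \<in> (\<lambda>y. [y, f y]) ` Y"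
    then obtain y where y: "y \<in> Y" "p = [y, f y]" by blast
    moreover have "y \<noteq> f y" using y(1) in_T YL disj by fastforce
    ultimately show "vpath p (with_proj D)" "hd p \<in> Y" "last p \<in> T"
      using f(2) in_T[OF y(1)] YL verts by (auto simp: vpath_def vwalk_def)
  next
    fix p q
    assume "p \<in> (\<lambda>y. [y, f y]) ` Y" "q \<in> (\<lambda>y. [y, f y]) ` Y" and neq: "p \<noteq> q"
    then obtain x y where xy: "x \<in> Y" "y \<in> Y" "p = [x, f x]" "q = [y, f y]" by blast
    then have "x \<noteq> y" using neq by auto
    moreover from this have "f x \<noteq> f y" using f(1) xy by (auto dest: inj_onD)
    moreover have "x \<noteq> f y" "y \<noteq> f x" using xy(1,2) in_T YL disj by fastforce+
    ultimately show "set p \<inter> set q = {}" using xy by auto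
  qed auto
  then show "\<exists>R. routing D Y T R" by blast
qed

section \<open>The Linkage Lemma\<close>

text \<open>
  The map sends a vertex to its successor on its path, if there is one. Heads of paths are not
  attained as values: they are no successors, and they lie on a path, so that they can only be
  fixed by the map if they are the last vertex of their path and thus belong to \<open>U\<close>.
\<close>

lemma routing_imp_linkage:
  assumes R: "routing D X T R" and fin: "finite X"
  obtains U n where "U \<subseteq> T" "finite U" "card U \<le> card X" "inj_on n (pverts D - U)"
    "n ` (pverts D - U) \<subseteq> pverts D - X"
    "\<forall>v\<in>pverts D - U. n v = v \<or> (v, n v) \<in> parcs D"
proof -
  let ?V = "pverts D"
  have path: "p \<noteq> []" "distinct p" "set p \<subseteq> ?V"
    "\<And>i. Suc i < length p \<Longrightarrow> (p ! i, p ! Suc i) \<in> parcs D" if "p \<in> R" for p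
    using R that by (auto simp: routing_def vpath_iff_nth)
  \<comment> \<open>A vertex determines both its path and its position on it.\<close>
  have unique: "p = q \<and> i = j"
    if "p \<in> R" "q \<in> R" "i < length p" "j < length q" "p ! i = q ! j" for p q i j
  proof -
    have "set p \<inter> set q \<noteq> {}" using that by (metis disjoint_iff nth_mem)
    then have "p = q" using R that(1,2) unfolding routing_def by blast
    then show ?thesis using that path(2) nth_eq_iff_index_eq by blast
  qed
  define U where "U = last ` R"
  have inj_hd: "inj_on hd R"
    by (rule inj_onI) (metis hd_conv_nth length_greater_0_conv path(1) unique)
  have hd_R: "hd ` R = X" using R by (auto simp: routing_def)
  have fin_R: "finite R" using fin inj_hd hd_R finite_imageD by metis
  have card_U: "card U \<le> card X"
    unfolding U_def using card_image_le[OF fin_R] card_image[OF inj_hd] hd_R by metis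
  have U_T: "U \<subseteq> T" using R by (auto simp: U_def routing_def)
  define next_on where
    "next_on v w \<longleftrightarrow> (\<exists>p\<in>R. \<exists>i. Suc i < length p \<and> p ! i = v \<and> p ! Suc i = w)" for v w
  define n where "n v = (if \<exists>w. next_on v w then THE w. next_on v w else v)" for v
  have next_fun: "w = w'" if "next_on v w" "next_on v w'" for v w w'
    using that unique unfolding next_on_def by (metis Suc_lessD)
  have next_inj: "v = v'" if "next_on v w" "next_on v' w" for v v' w
    using that unique unfolding next_on_def by (metis Suc_inject)
  have n_next: "n v = w" if "next_on v w" for v w
  proof -
    have "(THE w. next_on v w) = w" using that next_fun by (intro the_equality) auto
    then show ?thesis using that unfolding n_def by auto
  qed
  have n_cases: "next_on v (n v) \<or> (n v = v \<and> (\<forall>p\<in>R. v \<notin> set p))" if "v \<notin> U" for v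
  proof (cases "\<exists>p\<in>R. v \<in> set p")
    case True
    then obtain p i where p: "p \<in> R" "i < length p" "p ! i = v" by (metis in_set_conv_nth)
    have "Suc i \<noteq> length p"
    proof
      assume "Suc i = length p"
      then have "last p = v" using p path(1)[OF p(1)] by (metis diff_Suc_1 last_conv_nth)
      then show False using that p(1) by (auto simp: U_def)
    qed
    then have "next_on v (p ! Suc i)" using p unfolding next_on_def by (metis Suc_lessI)
    then show ?thesis using n_next by metis
  next
    case False
    then have "\<not> (\<exists>w. next_on v w)" unfolding next_on_def by (metis Suc_lessD nth_mem)
    then show ?thesis using False by (auto simp: n_def)
  qed
  have next_set: "\<exists>p\<in>R. w \<in> set p" if "next_on v w" for v w
    using that unfolding next_on_def by (metis nth_mem)
  have inj: "inj_on n (?V - U)"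
  proof (rule inj_onI)
    fix v v' assume "v \<in> ?V - U" "v' \<in> ?V - U" and eq: "n v = n v'"
    then show "v = v'"
      using n_cases[of v] n_cases[of v'] next_inj next_set by auto metis+
  qed
  have next_notin: "w \<notin> X" if "next_on v w" for v w
  proof
    assume "w \<in> X"
    then obtain q where q: "q \<in> R" "hd q = w" using hd_R by blast
    then have "q ! 0 = w" "0 < length q" using path(1) by (auto simp: hd_conv_nth)
    moreover obtain p i where "p \<in> R" "Suc i < length p" "p ! Suc i = w"
      using \<open>next_on v w\<close> unfolding next_on_def by blast
    ultimately show False using unique q(1) by (metis nat.distinct(1))
  qed
  have range: "n ` (?V - U) \<subseteq> ?V - X"
  proof
    fix w assume "w \<in> n ` (?V - U)"
    then obtain v where v: "v \<in> ?V" "v \<notin> U" "w = n v" by blast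
    show "w \<in> ?V - X"
    proof (cases "next_on v w")
      case True
      then show ?thesis using next_notin next_set path(3) by blast
    next
      case False
      then have "w = v" "\<forall>p\<in>R. v \<notin> set p" using n_cases v by auto
      moreover have "v \<notin> X" using calculation hd_R path(1) by (metis hd_in_set imageE)
      ultimately show ?thesis using v by simp
    qed
  qed
  have arcs: "\<forall>v\<in>?V - U. n v = v \<or> (v, n v) \<in> parcs D"
    using n_cases path(4) unfolding next_on_def by (metis DiffD2)
  show thesis
    using that[OF U_T _ card_U inj range arcs] fin_R by (simp add: U_def)
qed

text \<open>
  Cancelling \<open>n\<close> on both sides until one of the exponents is zero would otherwise exhibit \<open>x\<close> or
  \<open>y\<close> as a value of \<open>n\<close>.
\<close>

lemma iterates_from_outside_range:
  assumes inj: "inj_on n W" and x: "x \<notin> n ` W" and y: "y \<notin> n ` W"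
    and "\<forall>i'<i. (n ^^ i') x \<in> W" "\<forall>j'<j. (n ^^ j') y \<in> W" "(n ^^ i) x = (n ^^ j) y"
  shows "i = j \<and> x = y"
  using assms(4-)
proof (induction i arbitrary: j)
  case 0
  then show ?case using x by (cases j) auto
next
  case (Suc i)
  show ?case
  proof (cases j)
    case 0
    then show ?thesis using Suc.prems y by auto
  next
    case (Suc j')
    then have "(n ^^ i) x = (n ^^ j') y"
      using Suc.prems inj by (auto dest: inj_onD)
    then show ?thesis using Suc.IH[of j'] Suc.prems \<open>j = Suc j'\<close> by auto
  qed
qed

text \<open>
  The path of \<open>x \<in> X\<close> is its orbit under \<open>n\<close> up to the first vertex in \<open>U\<close>. All that is needed
  for distinctness and disjointness is that iterates starting outside the range of an injective
  map cannot coincide.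
\<close>

lemma linkage_imp_routing:
  assumes fin: "finite (pverts D)" and XV: "X \<subseteq> pverts D" and UT: "U \<subseteq> T"
    and inj: "inj_on n (pverts D - U)" and range: "n ` (pverts D - U) \<subseteq> pverts D - X"
    and arcs: "\<forall>v\<in>pverts D - U. n v = v \<or> (v, n v) \<in> parcs D"
  shows "\<exists>R. routing D X T R"
proof -
  let ?V = "pverts D"
  let ?W = "?V - U"
  have out: "x \<notin> n ` ?W" if "x \<in> X" for x using that range by blast
  have in_V: "(n ^^ i) x \<in> ?V" if "x \<in> X" "\<forall>j<i. (n ^^ j) x \<in> ?W" for x i
    using that XV range by (cases i) auto
  have reaches: "\<exists>i. (n ^^ i) x \<in> U" if x: "x \<in> X" for x
  proof (rule ccontr)
    assume never: "\<not> ?thesis"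
    have W: "(n ^^ i) x \<in> ?W" for i
    proof (induction i rule: less_induct)
      case (less i)
      then show ?case using in_V[OF x, of i] never by blast
    qed
    have "inj (\<lambda>i. (n ^^ i) x)"
      using iterates_from_outside_range[OF inj out[OF x] out[OF x]] W by (intro injI) blast
    moreover have "finite (range (\<lambda>i. (n ^^ i) x))"
      using fin W by (meson finite_Diff finite_subset image_subsetI)
    ultimately show False using finite_imageD by blast
  qed
  define k where "k x = (LEAST i. (n ^^ i) x \<in> U)" for x
  have k_U: "(n ^^ k x) x \<in> U" if "x \<in> X" for x
    unfolding k_def using reaches[OF that] by (rule LeastI_ex)
  have before_W: "(n ^^ i) x \<in> ?W" if "x \<in> X" "i < k x" for x i
    using that
  proof (induction i rule: less_induct)
    case (less i)
    have "(n ^^ i) x \<notin> U" using less.prems(2) not_less_Least unfolding k_def by blast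
    moreover have "\<forall>j<i. (n ^^ j) x \<in> ?W" using less by (meson less_trans)
    ultimately show ?case using in_V[OF less.prems(1), of i] by blast
  qed
  have unique: "i = j \<and> x = y"
    if "x \<in> X" "y \<in> X" "i \<le> k x" "j \<le> k y" "(n ^^ i) x = (n ^^ j) y" for x y i j
    using iterates_from_outside_range[OF inj out out, of x y i j] that before_W by simp
  define p where "p x = map (\<lambda>i. (n ^^ i) x) [0..<Suc (k x)]" for x
  have len: "length (p x) = Suc (k x)" for x by (simp add: p_def)
  have nth: "p x ! i = (n ^^ i) x" if "i \<le> k x" for x i
    using that by (simp add: p_def del: upt_Suc)
  have set_p: "set (p x) = {(n ^^ i) x | i. i \<le> k x}" for x
    by (auto simp: p_def less_Suc_eq_le simp del: upt_Suc)
  have nonempty: "p x \<noteq> []" for x using len[of x] by auto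
  have hd_p: "hd (p x) = x" for x using nonempty nth[of 0 x] by (simp add: hd_conv_nth)
  have last_p: "last (p x) = (n ^^ k x) x" for x
    using nonempty nth[of "k x" x] len by (simp add: last_conv_nth)
  have vpath_p: "vpath (p x) (with_proj D)" if x: "x \<in> X" for x
    unfolding vpath_iff_nth
  proof (intro conjI allI impI)
    show "p x \<noteq> []" by (rule nonempty)
    show "distinct (p x)"
      using unique[OF x x] nth len by (auto simp: distinct_conv_nth less_Suc_eq_le)
    show "set (p x) \<subseteq> ?V" using in_V[OF x] before_W[OF x] by (auto simp: set_p)
    fix i assume "Suc i < length (p x)"
    then have i: "Suc i \<le> k x" using len by simp
    \<comment> \<open>A fixed vertex of \<open>n\<close> would have to occur twice on the path.\<close>
    have "n ((n ^^ i) x) \<noteq> (n ^^ i) x" using unique[OF x x, of "Suc i" i] i by auto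
    then have "((n ^^ i) x, (n ^^ Suc i) x) \<in> parcs D"
      using arcs before_W[OF x, of i] i by auto
    then show "(p x ! i, p x ! Suc i) \<in> parcs D" using nth i by (metis Suc_leD)
  qed
  have "routing D X T (p ` X)"
    unfolding routing_def
  proof (intro conjI ballI impI)
    fix a b assume "a \<in> p ` X" "b \<in> p ` X" "a \<noteq> b"
    then obtain x y where xy: "x \<in> X" "y \<in> X" "a = p x" "b = p y" "x \<noteq> y" by blast
    then show "set a \<inter> set b = {}" using unique[OF xy(1,2)] by (auto simp: set_p)
  qed (use vpath_p hd_p last_p k_U UT in auto)
  then show ?thesis by blast
qed

section \<open>The bipartite unfolding of a digraph\<close>

locale bipartite_unfolding = pair_fin_digraph D for D :: "'a pair_pre_digraph" +
  fixes T E S :: "'a set" and dep arr :: "'a \<Rightarrow> 'a"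
  assumes T_verts: "T \<subseteq> pverts D" and E_verts: "E \<subseteq> pverts D" and fin_S: "finite S"
    and inj_dep: "inj_on dep (pverts D)" and inj_arr: "inj_on arr (pverts D)"
    and dep_E: "dep ` pverts D \<inter> E = {}"
    and arr_E: "arr ` pverts D \<inter> E = {}"
    and S_E: "S \<inter> E = {}"
    and dep_arr: "dep ` pverts D \<inter> arr ` pverts D = {}"
    and dep_S: "dep ` pverts D \<inter> S = {}"
    and arr_S: "arr ` pverts D \<inter> S = {}"
begin

definition sources :: "'a set" where "sources = E \<union> dep ` pverts D"

definition targets :: "'a set" where "targets = arr ` pverts D \<union> S"

text \<open>
  A partner \<open>arr v\<close> of \<open>dep v\<close> stands for a vertex \<open>v\<close> off all paths, a partner \<open>arr w\<close> with
  \<open>v \<noteq> w\<close> for the successor \<open>w\<close> of \<open>v\<close> on its path or on a cycle disjoint from all paths, and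
  a partner in \<open>S\<close> for a path that ends in \<open>v\<close>. An element \<open>e \<in> E\<close> in the matched set makes \<open>arr e\<close> unavailable, which forces \<open>e\<close>
  to be on a path and to have no predecessor.
\<close>

definition matching_arcs :: "('a \<times> 'a) set" where
  "matching_arcs =
     {(e, arr e) | e. e \<in> E} \<union>
     {(dep v, arr w) | v w. v \<in> pverts D \<and> w \<in> pverts D \<and> (v = w \<or> (v, w) \<in> parcs D)} \<union>
     {(dep t, s) | t s. t \<in> T \<and> s \<in> S}"

definition unfolded :: "'a pair_pre_digraph" where
  "unfolded = \<lparr>pverts = sources \<union> targets, parcs = matching_arcs\<rparr>"

lemma unfolded_simps [simp]:
  "pverts unfolded = sources \<union> targets" "parcs unfolded = matching_arcs"
  by (simp_all add: unfolded_def)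

lemma matching_arcs_subset: "matching_arcs \<subseteq> sources \<times> targets"
  using E_verts T_verts by (auto simp: matching_arcs_def sources_def targets_def)

lemma sources_targets_disjoint: "sources \<inter> targets = {}"
  using dep_E arr_E S_E dep_arr dep_S by (auto simp: sources_def targets_def)

lemma finite_sources: "finite sources" and finite_targets: "finite targets"
  using pair_finite_verts finite_subset[OF E_verts] fin_S
  by (simp_all add: sources_def targets_def)

lemma unfolded_fin_digraph: "pair_fin_digraph unfolded"
proof
  show "finite (pverts unfolded)" using finite_sources finite_targets by simp
  show "finite (parcs unfolded)"
    using finite_subset[OF matching_arcs_subset] finite_sources finite_targets by simp
qed (use matching_arcs_subset in auto)

lemma unfolded_acyclic: "acyclic_digraph unfolded"
  using acyclic_bipartite[OF _ sources_targets_disjoint, of unfolded] matching_arcs_subset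
  by simp

lemma unfolded_routing_iff_matching:
  assumes "Y \<subseteq> sources"
  shows "(\<exists>R. routing unfolded Y targets R) \<longleftrightarrow>
    (\<exists>f. inj_on f Y \<and> (\<forall>y\<in>Y. (y, f y) \<in> matching_arcs))"
  using bipartite_routing_iff_matching[OF _ sources_targets_disjoint, of unfolded Y]
    matching_arcs_subset assms by simp

lemma matching_arc_from_E: "e \<in> E \<Longrightarrow> (e, y) \<in> matching_arcs \<longleftrightarrow> y = arr e"
  using dep_E E_verts T_verts by (fastforce simp: matching_arcs_def)

lemma matching_arc_from_dep:
  assumes v: "v \<in> pverts D"
  shows "(dep v, y) \<in> matching_arcs \<longleftrightarrow>
    (\<exists>w\<in>pverts D. y = arr w \<and> (v = w \<or> (v, w) \<in> parcs D)) \<or> (v \<in> T \<and> y \<in> S)"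
proof -
  have "dep v \<notin> E" using dep_E v by blast
  moreover have "dep v = dep u \<longleftrightarrow> v = u" if "u \<in> pverts D" for u
    using inj_onD[OF inj_dep] v that by blast
  ultimately show ?thesis using v T_verts unfolding matching_arcs_def by blast
qed

text \<open>
  The elements of \<open>S\<close> serve as end markers for the paths, and any end of a path in \<open>T\<close> may use any
  of them; so \<open>S\<close> has to be as large as the number of paths.
\<close>

lemma routing_imp_matching:
  assumes R: "routing D X T R" and XE: "X \<subseteq> E" and card_X: "card X \<le> card S"
  shows "\<exists>R'. routing unfolded (X \<union> dep ` pverts D) targets R'"
proof -
  let ?V = "pverts D"
  have "finite X" using XE E_verts pair_finite_verts finite_subset by metis
  then obtain U n where U: "U \<subseteq> T" "finite U" "card U \<le> card X" and inj: "inj_on n (?V - U)"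
    and range: "n ` (?V - U) \<subseteq> ?V - X" and arcs: "\<forall>v\<in>?V - U. n v = v \<or> (v, n v) \<in> parcs D"
    using routing_imp_linkage[OF R] by blast
  obtain g where g: "g ` U \<subseteq> S" "inj_on g U"
    using card_le_inj[OF U(2) fin_S] U(3) card_X by auto
  define h where "h v = (if v \<in> U then g v else arr (n v))" for v
  define f where "f y = (if y \<in> E then arr y else h (inv_into ?V dep y))" for y
  have f_E: "f e = arr e" if "e \<in> E" for e using that by (simp add: f_def)
  have f_dep: "f (dep v) = h v" if "v \<in> ?V" for v
  proof -
    have "dep v \<notin> E" using dep_E that by blast
    then show ?thesis using that by (simp add: f_def inv_into_f_f[OF inj_dep])
  qed
  have n_V: "n v \<in> ?V" "n v \<notin> X" if "v \<in> ?V" "v \<notin> U" for v using that range by blast+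
  have g_S: "g v \<in> S" if "v \<in> U" for v using that g by blast
  have not_S: "arr v \<notin> S" if "v \<in> ?V" for v using that arr_S by blast
  have arr_eq: "arr v = arr w \<longleftrightarrow> v = w" if "v \<in> ?V" "w \<in> ?V" for v w
    using inj_onD[OF inj_arr] that by blast
  have inj_h: "v = w" if "v \<in> ?V" "w \<in> ?V" "h v = h w" for v w
  proof (cases "v \<in> U"; cases "w \<in> U")
    assume "v \<in> U" "w \<in> U"
    then show ?thesis using that g(2) by (auto simp: h_def dest: inj_onD)
  next
    assume "v \<notin> U" "w \<notin> U"
    then have "n v = n w" using that n_V arr_eq by (simp add: h_def)
    then show ?thesis using inj_onD[OF inj] that \<open>v \<notin> U\<close> \<open>w \<notin> U\<close> by blast
  qed (use that g_S not_S n_V in \<open>auto simp: h_def, metis+\<close>)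
  have h_X: "h v \<noteq> arr x" if "v \<in> ?V" "x \<in> X" for v x
  proof -
    have x: "x \<in> ?V" using that XE E_verts by blast
    show ?thesis
    proof (cases "v \<in> U")
      case True
      then show ?thesis using g_S[OF True] not_S[OF x] by (auto simp: h_def)
    next
      case False
      then show ?thesis using arr_eq[OF _ x] n_V that by (auto simp: h_def)
    qed
  qed
  have "inj_on f (X \<union> dep ` ?V)"
  proof (rule inj_onI)
    fix a b assume ab: "a \<in> X \<union> dep ` ?V" "b \<in> X \<union> dep ` ?V" "f a = f b"
    have XV: "X \<subseteq> ?V" using XE E_verts by blast
    consider "a \<in> X" "b \<in> X" | v where "a \<in> X" "v \<in> ?V" "b = dep v"
      | v where "b \<in> X" "v \<in> ?V" "a = dep v"
      | v w where "v \<in> ?V" "w \<in> ?V" "a = dep v" "b = dep w"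
      using ab by blast
    then show "a = b"
    proof cases
      case 1
      then show ?thesis using ab f_E XE arr_eq XV by (metis subsetD)
    next
      case 2
      then have "h v = arr a" using ab f_dep f_E XE by auto
      then show ?thesis using h_X 2 by blast
    next
      case 3
      then have "h v = arr b" using ab f_dep f_E XE by auto
      then show ?thesis using h_X 3 by blast
    next
      case 4
      then show ?thesis using ab f_dep inj_h by metis
    qed
  qed
  moreover have "(y, f y) \<in> matching_arcs" if y: "y \<in> X \<union> dep ` ?V" for y
  proof (cases "y \<in> X")
    case True
    then show ?thesis using f_E XE matching_arc_from_E by auto
  next
    case False
    then obtain v where v: "v \<in> ?V" "y = dep v" using y by blast
    have "(\<exists>w\<in>?V. h v = arr w \<and> (v = w \<or> (v, w) \<in> parcs D)) \<or> (v \<in> T \<and> h v \<in> S)"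
    proof (cases "v \<in> U")
      case True
      then show ?thesis using U(1) g_S by (auto simp: h_def)
    next
      case False
      then show ?thesis using n_V v arcs by (metis DiffI h_def)
    qed
    then show ?thesis using v f_dep matching_arc_from_dep by simp
  qed
  moreover have "X \<union> dep ` ?V \<subseteq> sources" using XE by (auto simp: sources_def)
  ultimately show ?thesis by (intro iffD2[OF unfolded_routing_iff_matching] exI[of _ f]) auto
qed

text \<open>
  Every \<open>x \<in> X\<close> uses up \<open>arr x\<close>, so the map read off from the partners of the departure vertices
  avoids \<open>X\<close>.
\<close>

lemma matching_imp_routing:
  assumes R': "routing unfolded (X \<union> dep ` pverts D) targets R'" and XE: "X \<subseteq> E"
  shows "\<exists>R. routing D X T R"
proof -
  let ?V = "pverts D"
  have "X \<union> dep ` ?V \<subseteq> sources" using XE by (auto simp: sources_def)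
  then obtain f where inj_f: "inj_on f (X \<union> dep ` ?V)"
    and f: "\<forall>y\<in>X \<union> dep ` ?V. (y, f y) \<in> matching_arcs"
    using R' unfolded_routing_iff_matching by blast
  define U where "U = {v \<in> ?V. f (dep v) \<in> S}"
  have XV: "X \<subseteq> ?V" using XE E_verts by blast
  have "U \<subseteq> T"
  proof
    fix v assume v: "v \<in> U"
    then have "(dep v, f (dep v)) \<in> matching_arcs" using f by (auto simp: U_def)
    then show "v \<in> T" using v matching_arc_from_dep arr_S by (auto simp: U_def)
  qed
  have "\<forall>v\<in>?V - U. \<exists>w\<in>?V. f (dep v) = arr w \<and> (v = w \<or> (v, w) \<in> parcs D)"
  proof
    fix v assume v: "v \<in> ?V - U"
    then have "(dep v, f (dep v)) \<in> matching_arcs" using f by auto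
    then show "\<exists>w\<in>?V. f (dep v) = arr w \<and> (v = w \<or> (v, w) \<in> parcs D)"
      using v matching_arc_from_dep by (auto simp: U_def)
  qed
  then obtain n where n: "\<forall>v\<in>?V - U. n v \<in> ?V \<and> f (dep v) = arr (n v) \<and>
      (v = n v \<or> (v, n v) \<in> parcs D)"
    by metis
  have "inj_on n (?V - U)"
  proof (rule inj_onI)
    fix v w assume vw: "v \<in> ?V - U" "w \<in> ?V - U" "n v = n w"
    then have "f (dep v) = f (dep w)" using n by metis
    then have "dep v = dep w" using inj_onD[OF inj_f] vw by blast
    then show "v = w" using inj_onD[OF inj_dep] vw by blast
  qed
  moreover have "n ` (?V - U) \<subseteq> ?V - X"
  proof
    fix x assume "x \<in> n ` (?V - U)"
    then obtain v where v: "v \<in> ?V - U" "x = n v" by blast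
    have "x \<notin> X"
    proof
      assume x: "x \<in> X"
      then have "f x = f (dep v)" using f v n XE matching_arc_from_E by (metis UnI1 subsetD)
      then have "x = dep v" using inj_onD[OF inj_f] x v by blast
      then show False using dep_E x v XE by blast
    qed
    then show "x \<in> ?V - X" using n v by blast
  qed
  moreover have "\<forall>v\<in>?V - U. n v = v \<or> (v, n v) \<in> parcs D" using n by metis
  ultimately show ?thesis
    using linkage_imp_routing[OF pair_finite_verts XV \<open>U \<subseteq> T\<close>] by blast
qed

lemma card_targets: "card targets = card S + card (sources - E)"
proof -
  have "sources - E = dep ` pverts D" using dep_E by (auto simp: sources_def)
  then show ?thesis
    using card_Un_disjoint[OF _ fin_S arr_S] pair_finite_verts
    by (simp add: targets_def card_image[OF inj_dep] card_image[OF inj_arr])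
qed

end

text \<open>
  The finitely many new vertices that the unfolding needs exist, since the vertices are taken from
  an infinite type.
\<close>

lemma unfolding_exists:
  fixes D :: "('a::infinite) pair_pre_digraph"
  assumes fin: "pair_fin_digraph D" and T: "T \<subseteq> pverts D" and E: "E \<subseteq> pverts D"
  obtains S dep arr where "bipartite_unfolding D T E S dep arr" "card S = r"
proof -
  interpret pair_fin_digraph D by (rule fin)
  let ?V = "pverts D"
  let ?K = "?V <+> (?V <+> {..<r})"
  have "finite E" using E pair_finite_verts finite_subset by blast
  then have "infinite (UNIV - E)" by (simp add: Diff_infinite_finite infinite_UNIV)
  then obtain B :: "'a set" where B: "finite B" "card B = card ?K" "B \<subseteq> UNIV - E"
    using infinite_arbitrarily_large by metis
  moreover have "finite ?K" using pair_finite_verts by simp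
  ultimately obtain j where j: "j ` ?K \<subseteq> B" "inj_on j ?K"
    using card_le_inj[of ?K B] by auto
  have notin_E: "j k \<notin> E" if "k \<in> ?K" for k using that j(1) B(3) by blast
  have j_eq: "j k = j k' \<longleftrightarrow> k = k'" if "k \<in> ?K" "k' \<in> ?K" for k k'
    using inj_onD[OF j(2)] that by blast
  define S where "S = (\<lambda>i. j (Inr (Inr i))) ` {..<r}"
  have "bipartite_unfolding D T E S (\<lambda>v. j (Inl v)) (\<lambda>v. j (Inr (Inl v)))"
    by unfold_locales
      (use T E notin_E j_eq in \<open>auto simp: S_def inj_on_def disjoint_iff InlI InrI\<close>)
  moreover have "card S = r"
    using card_image[of "\<lambda>i. j (Inr (Inr i))" "{..<r}"] j_eq
    by (auto simp: S_def inj_on_def InlI InrI)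
  ultimately show thesis using that by blast
qed

section \<open>Contracting an independent set\<close>

lemma contract_independent:
  assumes "\<forall>X Y. X \<in> indeps M \<and> Y \<subseteq> X \<longrightarrow> Y \<in> indeps M" "C \<in> indeps M"
  shows "contract M C = (ground M - C, {X. X \<subseteq> ground M - C \<and> X \<union> C \<in> indeps M})"
proof -
  have "basis_of M C B \<longleftrightarrow> B = C" for B
  proof
    assume B: "basis_of M C B"
    then have "x \<in> B" if "x \<in> C" for x
      using assms that unfolding basis_of_def by (metis DiffI insert_subset)
    then show "B = C" using B by (auto simp: basis_of_def)
  qed (use assms in \<open>auto simp: basis_of_def\<close>)
  then show ?thesis by (simp add: contract_def)
qed

lemma card_indep_le_rk:
  assumes "matroid M" "X \<in> indeps M"
  shows "card X \<le> rk M (ground M)"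
proof -
  have "finite (ground M)" "X \<subseteq> ground M"
    using assms by (auto simp: matroid_def)
  then show ?thesis using assms(2) unfolding rk_def by (intro Max_ge) auto
qed

section \<open>Gammoids from acyclic digraphs\<close>

theorem corollary3p5:
  fixes E :: "('a::infinite) set" and I :: "'a set set"
  assumes "gammoid (E, I)"
  shows "\<exists>(D :: 'a pair_pre_digraph) T E'.
           pair_fin_digraph D \<and> acyclic_digraph D \<and>
           T \<subseteq> pverts D \<and> E' \<subseteq> pverts D \<and> E \<subseteq> E' \<and>
           (E, I) = contract_to (gammoid_of D T E') E \<and>
           card T = rk (E, I) E + card (E' - E)"
proof -
  obtain D :: "'a pair_pre_digraph" and T where matroid: "matroid (E, I)"
    and D: "pair_fin_digraph D" "E \<subseteq> pverts D" "T \<subseteq> pverts D"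
    and EI: "(E, I) = gammoid_of D T E"
    using assms unfolding gammoid_def by auto
  have I: "X \<in> I \<longleftrightarrow> X \<subseteq> E \<and> (\<exists>R. routing D X T R)" for X
    using EI by (simp add: gammoid_of_def)
  obtain S dep arr where unf: "bipartite_unfolding D T E S dep arr" and card_S: "card S = rk (E, I) E"
    using unfolding_exists[OF D(1,3,2)] by metis
  interpret bipartite_unfolding D T E S dep arr by (rule unf)
  let ?N = "gammoid_of unfolded targets sources"
  let ?C = "dep ` pverts D"
  have ground: "sources - E = ?C" "sources - ?C = E"
    using dep_E by (auto simp: sources_def)
  have indep_iff: "X \<union> ?C \<in> indeps ?N \<longleftrightarrow> X \<in> I" if X: "X \<subseteq> E" for X
  proof
    assume "X \<union> ?C \<in> indeps ?N"
    then show "X \<in> I" using matching_imp_routing X I by (auto simp: gammoid_of_def)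
  next
    assume "X \<in> I"
    moreover from this have "card X \<le> card S"
      using card_indep_le_rk[OF matroid] card_S by simp
    ultimately show "X \<union> ?C \<in> indeps ?N"
      using routing_imp_matching X I by (auto simp: gammoid_of_def sources_def)
  qed
  have "{} \<in> I" using matroid by (simp add: matroid_def)
  then have C_indep: "?C \<in> indeps ?N" using indep_iff[of "{}"] by simp
  have hereditary: "\<forall>X Y. X \<in> indeps ?N \<and> Y \<subseteq> X \<longrightarrow> Y \<in> indeps ?N"
  proof (intro allI impI)
    fix X Y assume XY: "X \<in> indeps ?N \<and> Y \<subseteq> X"
    then have sub: "X \<subseteq> sources" "Y \<subseteq> sources" by (auto simp: gammoid_of_def)
    obtain f where f: "inj_on f X" "\<forall>y\<in>X. (y, f y) \<in> matching_arcs"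
      using XY unfolded_routing_iff_matching[OF sub(1)] by (auto simp: gammoid_of_def)
    have "Y \<subseteq> X" using XY by simp
    then have "inj_on f Y" "\<forall>y\<in>Y. (y, f y) \<in> matching_arcs"
      using f inj_on_subset by auto
    then have "\<exists>f. inj_on f Y \<and> (\<forall>y\<in>Y. (y, f y) \<in> matching_arcs)" by blast
    then show "Y \<in> indeps ?N"
      using unfolded_routing_iff_matching[OF sub(2)] sub(2) by (simp add: gammoid_of_def)
  qed
  have ground_N: "ground ?N = sources" by (simp add: gammoid_of_def)
  have "contract_to ?N E = contract ?N ?C"
    unfolding contract_to_def ground_N ground(1) ..
  also have "\<dots> = (E, {X. X \<subseteq> E \<and> X \<union> ?C \<in> indeps ?N})"
    using contract_independent[OF hereditary C_indep] unfolding ground_N ground(2) .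
  also have "\<dots> = (E, I)" using indep_iff I by auto
  finally have "(E, I) = contract_to ?N E" ..
  moreover have "card targets = rk (E, I) E + card (sources - E)"
    using card_targets card_S by simp
  moreover have "E \<subseteq> sources" by (auto simp: sources_def)
  ultimately show ?thesis
    using unfolded_fin_digraph unfolded_acyclic
    by (intro exI[of _ unfolded] exI[of _ targets] exI[of _ sources]) simp
qed

end
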